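(* $\mathrm{add}(\mathcal{M})=\min\{\mathrm{add}(\mathcal{H}_F): F\in\omega^\omega \text{ increasing}\}$ and $\mathrm{cof}(\mathcal{M})=\max\{\mathrm{cof}(\mathcal{H}_F): F\in\omega^\omega\text{ increasing}\}$.
   Context: $\mathcal{M}$ is the $\sigma$-ideal of meager subsets of $2^\omega$. $F\in\omega^\omega$ is increasing if $F(n)<F(n+1)$ for all $n$; we also assume $F(n)\geq 1$ for all $n$. $\Pi F=\prod_{n\in\omega}F(n)=\{x\in\omega^\omega: x(n)<F(n)\text{ for all } n\}$ with the product topology. An interval partition is a partition $I=(I_n)_{n\in\omega}$ of $\omega$ into consecutive finite nonempty intervals. $\mathcal{H}_F$ is the $\sigma$-ideal on $\Pi F$ generated by the sets $H_{I,y}=\{x\in\Pi F:\text{for all but finitely many } n\in\omega \text{ there is } k\in I_n \text{ with } x(k)=y(k)\}$, where $I$ is an interval partition and $y\in\Pi F$. For a $\sigma$-ideal $\mathcal{I}$: $\mathrm{add}(\mathcal{I})=\min\{|\mathcal{F}|:\mathcal{F}\subseteq\mathcal{I},\ \bigcup\mathcal{F}\notin\mathcal{I}\}$ and $\mathrm{cof}(\mathcal{I})=\min\{|\mathcal{F}|:\mathcal{F}\subseteq\mathcal{I},\ \forall Y\in\mathcal{I}\ \exists Y'\in\mathcal{F}\ Y\subseteq Y'\}$. *)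

theory Defs
  imports "HOL-Analysis.Analysis"
begin

unbundle cardinal_syntax

section \<open>Minima and maxima of sets of cardinals\<close>

text \<open>
  Cardinals are represented by well-orders up to order isomorphism, so ``\<open>\<kappa>\<close> is the minimum
  (maximum) of \<open>K\<close>'' means that \<open>\<kappa>\<close> is isomorphic to some member of \<open>K\<close> and bounds \<open>K\<close> from
  below (above). The type of \<open>\<kappa>\<close> may differ from the type of the members of \<open>K\<close>.
\<close>

definition is_min_card :: "'a rel \<Rightarrow> 'b rel set \<Rightarrow> bool" where
  "is_min_card \<kappa> K \<longleftrightarrow> (\<exists>\<mu>\<in>K. \<kappa> =o \<mu>) \<and> (\<forall>\<mu>\<in>K. \<kappa> \<le>o \<mu>)"

definition is_max_card :: "'a rel \<Rightarrow> 'b rel set \<Rightarrow> bool" where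
  "is_max_card \<kappa> K \<longleftrightarrow> (\<exists>\<mu>\<in>K. \<kappa> =o \<mu>) \<and> (\<forall>\<mu>\<in>K. \<mu> \<le>o \<kappa>)"

definition min_card :: "'a rel set \<Rightarrow> 'a rel" where
  "min_card K = (SOME \<kappa>. \<kappa> \<in> K \<and> is_min_card \<kappa> K)"

lemma min_card:
  assumes "K \<noteq> {}" and "\<forall>\<kappa>\<in>K. Card_order \<kappa>"
  shows "min_card K \<in> K \<and> is_min_card (min_card K) K"
proof -
  obtain \<kappa> where \<kappa>: "\<kappa> \<in> K" "\<forall>\<mu>\<in>K. \<kappa> \<le>o \<mu>"
    using exists_minim_Card_order[OF assms] by blast
  then have "\<kappa> \<in> K \<and> is_min_card \<kappa> K"
    unfolding is_min_card_def using assms(2) card_order_on_well_order_on ordIso_reflexive by blast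
  then show ?thesis
    unfolding min_card_def by (rule someI)
qed

section \<open>\<open>\<sigma>\<close>-ideals and their cardinal invariants\<close>

definition sigma_ideal :: "'a set \<Rightarrow> 'a set set \<Rightarrow> bool" where
  "sigma_ideal X \<J> \<longleftrightarrow>
     \<J> \<subseteq> Pow X \<and>
     (\<forall>A\<in>\<J>. \<forall>B. B \<subseteq> A \<longrightarrow> B \<in> \<J>) \<and>
     (\<forall>\<C>. countable \<C> \<and> \<C> \<subseteq> \<J> \<longrightarrow> \<Union>\<C> \<in> \<J>)"

definition sigma_ideal_generated :: "'a set \<Rightarrow> 'a set set \<Rightarrow> 'a set set" where
  "sigma_ideal_generated X \<G> = \<Inter>{\<J>. sigma_ideal X \<J> \<and> \<G> \<subseteq> \<J>}"

text \<open>
  The additivity is meaningful only if \<open>\<Union>\<J> \<notin> \<J>\<close>, as for proper ideals that cover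
  the underlying set; otherwise the minimum is over the empty set.
\<close>

definition additivity :: "'a set set \<Rightarrow> 'a set rel" where
  "additivity \<J> = min_card {|\<F>| | \<F>. \<F> \<subseteq> \<J> \<and> \<Union>\<F> \<notin> \<J>}"

definition cofinality :: "'a set set \<Rightarrow> 'a set rel" where
  "cofinality \<J> = min_card {|\<F>| | \<F>. \<F> \<subseteq> \<J> \<and> (\<forall>Y\<in>\<J>. \<exists>Y'\<in>\<F>. Y \<subseteq> Y')}"

lemma additivity:
  assumes "\<Union>\<J> \<notin> \<J>"
  shows "is_min_card (additivity \<J>) {|\<F>| | \<F>. \<F> \<subseteq> \<J> \<and> \<Union>\<F> \<notin> \<J>}"
  unfolding additivity_def by (rule min_card[THEN conjunct2]) (use assms in \<open>auto simp: card_of_Card_order\<close>)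

lemma cofinality:
  "is_min_card (cofinality \<J>) {|\<F>| | \<F>. \<F> \<subseteq> \<J> \<and> (\<forall>Y\<in>\<J>. \<exists>Y'\<in>\<F>. Y \<subseteq> Y')}"
  unfolding cofinality_def by (rule min_card[THEN conjunct2]) (auto simp: card_of_Card_order)

section \<open>The meager ideal on the Cantor space\<close>

definition nowhere_dense :: "'a::topological_space set \<Rightarrow> bool" where
  "nowhere_dense A \<longleftrightarrow> interior (closure A) = {}"

definition meager :: "'a::topological_space set \<Rightarrow> bool" where
  "meager A \<longleftrightarrow> (\<exists>\<C>. countable \<C> \<and> (\<forall>N\<in>\<C>. nowhere_dense N) \<and> A = \<Union>\<C>)"

text \<open>
  The Cantor space is the type \<^typ>\<open>nat \<Rightarrow> bool\<close>, whose library topology is the product of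
  the discrete topologies on \<^typ>\<open>bool\<close>.
\<close>

definition meager_ideal :: "(nat \<Rightarrow> bool) set set" where
  "meager_ideal = {A. meager A}"

section \<open>The ideals \<open>\<H>\<^sub>F\<close>\<close>

definition increasing_seq :: "(nat \<Rightarrow> nat) \<Rightarrow> bool" where
  "increasing_seq F \<longleftrightarrow> (\<forall>n. F n < F (Suc n)) \<and> (\<forall>n. F n \<ge> 1)"

definition prod_space :: "(nat \<Rightarrow> nat) \<Rightarrow> (nat \<Rightarrow> nat) set" where
  "prod_space F = {x. \<forall>n. x n < F n}"

definition interval_partition :: "(nat \<Rightarrow> nat set) \<Rightarrow> bool" where
  "interval_partition I \<longleftrightarrow>
     (\<exists>a. a 0 = 0 \<and> strict_mono a \<and> (\<forall>n. I n = {a n..<a (Suc n)}))"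

definition H_set :: "(nat \<Rightarrow> nat) \<Rightarrow> (nat \<Rightarrow> nat set) \<Rightarrow> (nat \<Rightarrow> nat) \<Rightarrow> (nat \<Rightarrow> nat) set" where
  "H_set F I y = {x \<in> prod_space F. \<forall>\<^sub>F n in sequentially. \<exists>k\<in>I n. x k = y k}"

definition H_ideal :: "(nat \<Rightarrow> nat) \<Rightarrow> (nat \<Rightarrow> nat) set set" where
  "H_ideal F = sigma_ideal_generated (prod_space F)
     {H_set F I y | I y. interval_partition I \<and> y \<in> prod_space F}"

end

theory Submission
  imports Defs
begin

text \<open>
  Inclusion between the generating sets is combinatorial: \<open>H\<^bsub>I,y\<^esub> \<subseteq> H\<^bsub>J,z\<^esub>\<close> iff almost every \<open>J n\<close>
  contains some \<open>I k\<close> on which \<open>y\<close> and \<open>z\<close> agree. This needs only that every coordinate beyond the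
  first takes at least two values. For functions into \<open>{0,1}\<close> the condition \<open>x k = y k\<close> means
  \<open>x k \<noteq> 1 - y k\<close>, so by the classical characterisation of meager sets the same construction over
  the Cantor space yields the meager ideal. Coding \<open>\<Pi>F\<close> into bits and embedding bits
  into \<open>\<Pi>F\<close> gives Tukey reductions in both directions between the meager ideal and \<open>\<H>\<^sub>F\<close>,
  for every increasing \<open>F\<close>. Hence all the additivities coincide, as do the cofinalities.
\<close>

section \<open>Tukey reductions\<close>

text \<open>The maps \<open>f\<close> and \<open>g\<close> form a Tukey connection between the
  inclusion orders: unbounded families are pushed forward along \<open>f\<close>, cofinal ones
  pulled back along \<open>g\<close>.\<close>

definition tukey_reducible :: "'a set set \<Rightarrow> 'b set set \<Rightarrow> bool" where
  "tukey_reducible J K \<longleftrightarrow>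
     (\<exists>f g. f ` J \<subseteq> K \<and> g ` K \<subseteq> J \<and> (\<forall>A\<in>J. \<forall>B\<in>K. f A \<subseteq> B \<longrightarrow> A \<subseteq> g B))"

text \<open>If the image family under \<open>f\<close> had its union in \<open>K\<close>, then
  \<open>g\<close> would turn that union into a bound of \<open>\<F>\<close> in
  \<open>J\<close>.\<close>

lemma tukey_reducible_unbounded:
  assumes "tukey_reducible J K" and down: "\<forall>A\<in>J. Pow A \<subseteq> J"
    and "\<F> \<subseteq> J" "\<Union>\<F> \<notin> J"
  obtains \<G> where "\<G> \<subseteq> K" "\<Union>\<G> \<notin> K" "|\<G>| \<le>o |\<F>|"
proof -
  obtain f g where f: "f ` J \<subseteq> K" and g: "g ` K \<subseteq> J"
    and fg: "\<forall>A\<in>J. \<forall>B\<in>K. f A \<subseteq> B \<longrightarrow> A \<subseteq> g B"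
    using assms(1) unfolding tukey_reducible_def by (elim exE conjE)
  have "\<Union>(f ` \<F>) \<notin> K"
  proof
    assume B: "\<Union>(f ` \<F>) \<in> K"
    have sub: "\<Union>\<F> \<subseteq> g (\<Union>(f ` \<F>))"
      using fg B assms(3) by blast
    have "Pow (g (\<Union>(f ` \<F>))) \<subseteq> J"
      by (rule bspec[OF down subsetD[OF g imageI[OF B]]])
    then have "\<Union>\<F> \<in> J"
      by (rule subsetD[OF _ PowI[OF sub]])
    with assms(4) show False ..
  qed
  moreover have "f ` \<F> \<subseteq> K"
    using f assms(3) by blast
  ultimately show thesis
    using that[of "f ` \<F>"] card_of_image[of f \<F>] by simp
qed

lemma tukey_reducible_additivity:
  assumes "tukey_reducible J K" and "\<forall>A\<in>J. Pow A \<subseteq> J" and "\<forall>A\<in>K. Pow A \<subseteq> K"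
    and "\<Union>J \<notin> J"
  shows "additivity K \<le>o additivity J"
proof -
  obtain \<F> where \<F>: "\<F> \<subseteq> J" "\<Union>\<F> \<notin> J" "additivity J =o |\<F>|"
    using additivity[OF assms(4)] unfolding is_min_card_def by blast
  obtain \<G> where \<G>: "\<G> \<subseteq> K" "\<Union>\<G> \<notin> K" "|\<G>| \<le>o |\<F>|"
    by (rule tukey_reducible_unbounded[OF assms(1,2) \<F>(1,2)]) (rule that)
  \<comment> \<open>This makes \<open>additivity K\<close> a minimum over a nonempty set.\<close>
  have "\<Union>K \<notin> K"
    using \<G>(2) subsetD[OF bspec[OF assms(3)] PowI[OF Union_mono[OF \<G>(1)]]] by (rule contrapos_nn)
  then have "additivity K \<le>o |\<G>|"
    by (rule bspec[OF conjunct2[OF additivity[unfolded is_min_card_def]]]) (use \<G>(1,2) in blast)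
  then show ?thesis
    by (rule ordLeq_transitive[OF _ ordLeq_ordIso_trans[OF \<G>(3) ordIso_symmetric[OF \<F>(3)]]])
qed

lemma tukey_reducible_cofinality:
  assumes "tukey_reducible J K"
  shows "cofinality J \<le>o cofinality K"
proof -
  obtain f g where f: "f ` J \<subseteq> K" and g: "g ` K \<subseteq> J"
    and fg: "\<forall>A\<in>J. \<forall>B\<in>K. f A \<subseteq> B \<longrightarrow> A \<subseteq> g B"
    using assms(1) unfolding tukey_reducible_def by (elim exE conjE)
  obtain \<F> where \<F>: "\<F> \<subseteq> K" "\<forall>Y\<in>K. \<exists>Y'\<in>\<F>. Y \<subseteq> Y'" "cofinality K =o |\<F>|"
    using conjunct1[OF cofinality[of K, unfolded is_min_card_def]]
    by (elim bexE CollectE exE conjE) (simp only:)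
  have "g ` \<F> \<subseteq> J"
    using g \<F>(1) by blast
  moreover have "\<exists>Y'\<in>g ` \<F>. Y \<subseteq> Y'" if "Y \<in> J" for Y
  proof -
    have "f Y \<in> K"
      using that by (intro subsetD[OF f] imageI)
    then obtain B where B: "B \<in> \<F>" "f Y \<subseteq> B"
      by (rule bexE[OF bspec[OF \<F>(2)]])
    have "B \<in> K" using B(1) \<F>(1) by blast
    then have "Y \<subseteq> g B"
      by (rule mp[OF bspec[OF bspec[OF fg that]] B(2)])
    then show ?thesis using B(1) by blast
  qed
  ultimately have "cofinality J \<le>o |g ` \<F>|"
    by (intro bspec[OF conjunct2[OF cofinality[unfolded is_min_card_def]]] CollectI exI[of _ "g ` \<F>"] conjI refl ballI)
  then show ?thesis
    by (rule ordLeq_transitive[OF _ ordLeq_ordIso_trans[OF card_of_image ordIso_symmetric[OF \<F>(3)]]])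
qed

section \<open>Matching sets\<close>

text \<open>An interval partition is represented by its left endpoints; block \<open>n\<close> is
  \<open>{a n..<a (Suc n)}\<close>.\<close>

definition partition_seq :: "(nat \<Rightarrow> nat) \<Rightarrow> bool" where
  "partition_seq a \<longleftrightarrow> a 0 = 0 \<and> strict_mono a"

definition match_codes :: "(nat \<Rightarrow> 'a set) \<Rightarrow> ((nat \<Rightarrow> nat) \<times> (nat \<Rightarrow> 'a)) set" where
  "match_codes S = {(a, y). partition_seq a \<and> y \<in> Pi UNIV S}"

fun match_set :: "(nat \<Rightarrow> 'a set) \<Rightarrow> (nat \<Rightarrow> nat) \<times> (nat \<Rightarrow> 'a) \<Rightarrow> (nat \<Rightarrow> 'a) set" where
  "match_set S (a, y) =
     {x \<in> Pi UNIV S. \<forall>\<^sub>F n in sequentially. \<exists>i\<in>{a n..<a (Suc n)}. x i = y i}"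

text \<open>Only subsets of single matching sets are taken; closure under countable unions is a
  theorem, obtained from the directedness of codes.\<close>

definition matching_ideal :: "(nat \<Rightarrow> 'a set) \<Rightarrow> (nat \<Rightarrow> 'a) set set" where
  "matching_ideal S = {A. \<exists>p\<in>match_codes S. A \<subseteq> match_set S p}"

text \<open>The code of the larger set comes first: \<open>engulfs q p\<close> stands for the
  inclusion of the matching set of \<open>p\<close> in that of \<open>q\<close>.\<close>

fun engulfs :: "(nat \<Rightarrow> nat) \<times> (nat \<Rightarrow> 'a) \<Rightarrow> (nat \<Rightarrow> nat) \<times> (nat \<Rightarrow> 'a) \<Rightarrow> bool" where
  "engulfs (b, z) (a, y) \<longleftrightarrow>
     (\<forall>\<^sub>F n in sequentially. \<exists>k. b n \<le> a k \<and> a (Suc k) \<le> b (Suc n) \<and>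
        (\<forall>i\<in>{a k..<a (Suc k)}. y i = z i))"

section \<open>Blocks of interval partitions\<close>

lemma partition_seq_ge: "partition_seq a \<Longrightarrow> n \<le> a n"
  unfolding partition_seq_def by (simp add: strict_mono_imp_increasing)

lemma partition_seq_less_iff: "partition_seq a \<Longrightarrow> a m < a n \<longleftrightarrow> m < n"
  unfolding partition_seq_def by (simp add: strict_mono_less)

lemma partition_seq_le_iff: "partition_seq a \<Longrightarrow> a m \<le> a n \<longleftrightarrow> m \<le> n"
  unfolding partition_seq_def by (simp add: strict_mono_less_eq)

lemma partition_seq_block:
  assumes "partition_seq a"
  obtains n where "a n \<le> i" "i < a (Suc n)"
proof -
  have ex: "i < a (Suc i)"
    using partition_seq_ge[OF assms, of "Suc i"] by simp
  define n where "n = (LEAST n. i < a (Suc n))"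
  have "i < a (Suc n)"
    unfolding n_def using ex by (rule LeastI)
  moreover have "a n \<le> i"
  proof (cases n)
    case 0
    then show ?thesis using assms by (simp add: partition_seq_def)
  next
    case (Suc m)
    then have "\<not> i < a (Suc m)"
      using not_less_Least[of m "\<lambda>n. i < a (Suc n)"] n_def by simp
    then show ?thesis using Suc by simp
  qed
  ultimately show thesis using that by blast
qed

lemma partition_seq_block_unique:
  assumes "partition_seq a" "a n \<le> i" "i < a (Suc n)" "a m \<le> i" "i < a (Suc m)"
  shows "m = n"
proof -
  have "m < Suc n" "n < Suc m"
    using assms partition_seq_less_iff[OF assms(1)] by (meson le_less_trans)+
  then show ?thesis by simp
qed

lemma partition_seq_glue:
  assumes "partition_seq a" "\<And>n. w n \<in> Pi UNIV S"
  obtains y where "y \<in> Pi UNIV S" "\<And>n i. i \<in> {a n..<a (Suc n)} \<Longrightarrow> y i = w n i"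
proof -
  have "\<exists>n. a n \<le> i \<and> i < a (Suc n)" for i
    using partition_seq_block[OF assms(1)] by blast
  then obtain N where N: "\<And>i. a (N i) \<le> i" "\<And>i. i < a (Suc (N i))"
    by metis
  have "(\<lambda>i. w (N i) i) \<in> Pi UNIV S"
    using assms(2) by (auto simp: Pi_iff)
  moreover have "w (N i) i = w n i" if "i \<in> {a n..<a (Suc n)}" for n i
    using partition_seq_block_unique[OF assms(1) N, of n] that by simp
  ultimately show thesis using that by blast
qed

lemma engulfs_imp_match_set_subset:
  assumes "p \<in> match_codes S" "q \<in> match_codes S" "engulfs q p"
  shows "match_set S p \<subseteq> match_set S q"
proof
  fix x assume x: "x \<in> match_set S p"
  obtain a y b z where pq: "p = (a, y)" "q = (b, z)"
    and a: "partition_seq a" and b: "partition_seq b"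
    using assms(1,2) by (auto simp: match_codes_def)
  obtain N where N: "\<And>k. N \<le> k \<Longrightarrow> \<exists>i\<in>{a k..<a (Suc k)}. x i = y i"
    using x by (auto simp: pq eventually_sequentially)
  have "\<forall>\<^sub>F n in sequentially. \<exists>i\<in>{b n..<b (Suc n)}. x i = z i"
    using assms(3)[unfolded pq engulfs.simps] eventually_ge_at_top[of "a N"]
  proof eventually_elim
    case (elim n)
    then obtain k where k: "b n \<le> a k" "a (Suc k) \<le> b (Suc n)"
      "\<forall>i\<in>{a k..<a (Suc k)}. y i = z i" by blast
    \<comment> \<open>Since \<open>b n \<ge> n \<ge> a N\<close>, the engulfed block lies beyond the
      finitely many blocks on which \<open>x\<close> may miss \<open>y\<close>.\<close>
    have "a N \<le> a k"
      using elim(2) k(1) partition_seq_ge[OF b, of n] by simp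
    then obtain i where "i \<in> {a k..<a (Suc k)}" "x i = y i"
      using N partition_seq_le_iff[OF a] by blast
    then show ?case
      using k by (intro bexI[of _ i]) auto
  qed
  then show "x \<in> match_set S q"
    using x by (simp add: pq)
qed

text \<open>Elements are chosen recursively, each at least \<open>h\<close> of its predecessor;
  monotonicity extends the gap from consecutive elements to all pairs.\<close>

lemma sparse_subset:
  fixes B :: "nat set" and h :: "nat \<Rightarrow> nat"
  assumes "infinite B"
  obtains D where "D \<subseteq> B" "infinite D" "\<And>m n. m \<in> D \<Longrightarrow> n \<in> D \<Longrightarrow> m < n \<Longrightarrow> h m \<le> n"
proof -
  have ex: "\<exists>n. n \<in> B \<and> k \<le> n" for k
    using assms infinite_nat_iff_unbounded_le by blast
  have "\<exists>r. \<forall>j. r j \<in> B \<and> (r j < r (Suc j) \<and> h (r j) \<le> r (Suc j))"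
  proof (rule dependent_nat_choice)
    fix n j :: nat
    show "\<exists>m. m \<in> B \<and> (n < m \<and> h n \<le> m)"
      using ex[of "max (Suc n) (h n)"] by auto
  qed (use ex in blast)
  then obtain r where r: "\<And>j. r j \<in> B" "\<And>j. r j < r (Suc j)" "\<And>j. h (r j) \<le> r (Suc j)"
    by blast
  have mono: "strict_mono r"
    using r(2) by (simp add: strict_mono_Suc_iff)
  show thesis
  proof (rule that[of "range r"])
    show "infinite (range r)"
      using mono by (simp add: range_inj_infinite strict_mono_imp_inj_on)
    fix m n assume "m \<in> range r" "n \<in> range r" "m < n"
    then obtain i j where ij: "m = r i" "n = r j" "i < j"
      using mono strict_mono_less by blast
    then show "h m \<le> n"
      using r(3)[of i] mono by (meson Suc_leI order_trans strict_mono_less_eq)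
  qed (use r(1) in auto)
qed

text \<open>
  If \<open>q = (b, z)\<close> fails to engulf \<open>p = (a, y)\<close> on infinitely many blocks of \<open>b\<close>, pass to blocks so
  sparse that no block of \<open>a\<close> meets two of them; a function that avoids \<open>z\<close> on these blocks but takes
  the value of \<open>y\<close> wherever \<open>z\<close> permits it still agrees with \<open>y\<close> somewhere on every block of \<open>a\<close>.
  At index 0 there may be only one value available, hence the restriction to \<open>n > 0\<close>.
\<close>
lemma match_set_subset_imp_engulfs:
  assumes p: "p \<in> match_codes S" and q: "q \<in> match_codes S"
    and two: "\<And>n c. n > 0 \<Longrightarrow> \<exists>d\<in>S n. d \<noteq> c"
    and sub: "match_set S p \<subseteq> match_set S q"
  shows "engulfs q p"
proof (rule ccontr)
  assume neg: "\<not> engulfs q p"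
  obtain a y b z where pq: "p = (a, y)" "q = (b, z)"
    and a: "partition_seq a" and b: "partition_seq b"
    and y: "y \<in> Pi UNIV S" and z: "z \<in> Pi UNIV S"
    using p q by (auto simp: match_codes_def)
  define Q where "Q n \<longleftrightarrow> (\<exists>k. b n \<le> a k \<and> a (Suc k) \<le> b (Suc n) \<and>
        (\<forall>i\<in>{a k..<a (Suc k)}. y i = z i))" for n
  have "\<exists>n\<ge>Suc m. \<not> Q n" for m
    using neg unfolding pq engulfs.simps eventually_sequentially Q_def by blast
  then have "\<exists>n\<ge>m. n \<in> {n. n > 0 \<and> \<not> Q n}" for m
    by (metis Suc_leD Suc_le_lessD less_nat_zero_code mem_Collect_eq not_gr_zero)
  then have "infinite {n. n > 0 \<and> \<not> Q n}"
    using infinite_nat_iff_unbounded_le by blast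
  \<comment> \<open>A block of \<open>a\<close> that starts before \<open>b (Suc m)\<close> has
    index below \<open>b (Suc m)\<close>, so it ends by \<open>a (b (Suc m))\<close>, hence no later
    than the start of the next chosen block of \<open>b\<close>.\<close>
  then obtain D where D: "D \<subseteq> {n. n > 0 \<and> \<not> Q n}" "infinite D"
    "\<And>m n. m \<in> D \<Longrightarrow> n \<in> D \<Longrightarrow> m < n \<Longrightarrow> a (b (Suc m)) \<le> n"
    using sparse_subset[of _ "\<lambda>m. a (b (Suc m))"] by metis
  define U where "U = (\<Union>n\<in>D. {b n..<b (Suc n)})"
  have Upos: "i > 0" if "i \<in> U" for i
  proof -
    obtain n where n: "n \<in> D" "b n \<le> i"
      using \<open>i \<in> U\<close> by (auto simp: U_def)
    then have "n > 0" using D(1) by blast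
    then show ?thesis using n(2) partition_seq_ge[OF b, of n] by simp
  qed
  define c where "c i = (SOME d. d \<in> S i \<and> d \<noteq> z i)" for i
  have c: "c i \<in> S i \<and> c i \<noteq> z i" if "i > 0" for i
    unfolding c_def using two[OF that, of "z i"] by (rule bexE) (rule someI, blast)
  define x where "x i = (if i \<in> U \<and> y i = z i then c i else y i)" for i
  have xz: "x i \<noteq> z i" if "i \<in> U" for i
    using that c Upos by (auto simp: x_def)
  have xS: "x \<in> Pi UNIV S"
    using y c Upos by (auto simp: x_def Pi_iff)
  have "\<exists>i\<in>{a k..<a (Suc k)}. x i = y i" for k
  proof (rule ccontr)
    assume "\<not> ?thesis"
    \<comment> \<open>\<open>x\<close> leaves \<open>y\<close> only inside \<open>U\<close> and only
      where \<open>y\<close> equals \<open>z\<close>. A block of \<open>a\<close> without agreement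
      therefore lies in \<open>U\<close>, by sparseness in one block of \<open>b\<close>, which
      contradicts the failure of \<open>Q\<close> there.\<close>
    then have *: "i \<in> U \<and> y i = z i" if "i \<in> {a k..<a (Suc k)}" for i
      using that by (metis x_def)
    have ak: "a k < a (Suc k)"
      using partition_seq_less_iff[OF a] by simp
    then obtain n where n: "n \<in> D" "b n \<le> a k" "a k < b (Suc n)"
      using *[of "a k"] by (auto simp: U_def)
    have "i < b (Suc n)" if i: "i \<in> {a k..<a (Suc k)}" for i
    proof -
      obtain m where m: "m \<in> D" "b m \<le> i" "i < b (Suc m)"
        using *[OF i] by (auto simp: U_def)
      have "b n < b (Suc m)"
        using n(2) m(3) i by simp
      then have "n \<le> m"
        using partition_seq_less_iff[OF b] by simp
      moreover have "\<not> n < m"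
      proof
        assume "n < m"
        then have "a (b (Suc n)) \<le> i"
          using D(3)[OF n(1) m(1)] m(2) partition_seq_ge[OF b, of m] by simp
        moreover have "Suc k \<le> b (Suc n)"
          using n(3) partition_seq_ge[OF a, of k] by simp
        then have "a (Suc k) \<le> a (b (Suc n))"
          using partition_seq_le_iff[OF a] by simp
        ultimately show False using i by simp
      qed
      ultimately show ?thesis using m(3) by simp
    qed
    \<comment> \<open>The last index of the block controls its right endpoint.\<close>
    from this[of "a (Suc k) - 1"] have "a (Suc k) \<le> b (Suc n)"
      using ak by force
    then have "Q n"
      unfolding Q_def using n(2) * by blast
    then show False using n(1) D(1) by blast
  qed
  then have "x \<in> match_set S p"
    using xS by (simp add: pq)
  then have "x \<in> match_set S (b, z)"
    using sub pq by blast
  then obtain N where N: "\<And>n. n \<ge> N \<Longrightarrow> \<exists>i\<in>{b n..<b (Suc n)}. x i = z i"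
    by (auto simp: eventually_sequentially)
  obtain n where "n \<in> D" "n \<ge> N"
    using D(2) infinite_nat_iff_unbounded_le by blast
  then show False
    using N[of n] xz unfolding U_def by blast
qed

text \<open>A diagonal construction: block \<open>n\<close> of \<open>b\<close> is long enough to
  hold a full block of each \<open>a j\<close> with \<open>j < n\<close>, and \<open>z\<close>
  copies \<open>y j\<close> there. So \<open>p j\<close> is engulfed from \<open>n = j + 1\<close>
  on.\<close>

lemma match_codes_directed:
  fixes p :: "nat \<Rightarrow> (nat \<Rightarrow> nat) \<times> (nat \<Rightarrow> 'a)"
  assumes p: "\<And>j. p j \<in> match_codes S"
  obtains q where "q \<in> match_codes S" "\<And>j. engulfs q (p j)"
proof -
  define a where "a j = fst (p j)" for j
  define y where "y j = snd (p j)" for j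
  have a: "partition_seq (a j)" and y: "y j \<in> Pi UNIV S" for j
    using p[of j] by (auto simp: a_def y_def match_codes_def)
  have step: "\<exists>e w. d < e \<and> w \<in> Pi UNIV S \<and> (\<forall>j<n. \<exists>k. d \<le> a j k \<and> a j (Suc k) \<le> e \<and>
      (\<forall>i\<in>{a j k..<a j (Suc k)}. y j i = w i))" for d n
  proof (induction n)
    case 0
    show ?case using y[of 0] by auto
  next
    case (Suc n)
    then obtain e w where e: "d < e" "w \<in> Pi UNIV S" and
      *: "\<And>j. j < n \<Longrightarrow> \<exists>k. d \<le> a j k \<and> a j (Suc k) \<le> e \<and> (\<forall>i\<in>{a j k..<a j (Suc k)}. y j i = w i)"
      by blast
    define w' where "w' i = (if i < e then w i else y n i)" for i
    \<comment> \<open>Block number \<open>e\<close> of \<open>a n\<close> starts at or after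
      \<open>e\<close>, so copying \<open>y n\<close> there leaves the earlier agreements
      intact.\<close>
    have e': "e \<le> a n e" "e < a n (Suc e)"
      using partition_seq_ge[OF a[of n], of e] partition_seq_ge[OF a[of n], of "Suc e"] by auto
    have "w' \<in> Pi UNIV S"
      using e(2) y[of n] by (auto simp: w'_def Pi_iff)
    moreover have "\<exists>k. d \<le> a j k \<and> a j (Suc k) \<le> a n (Suc e) \<and>
        (\<forall>i\<in>{a j k..<a j (Suc k)}. y j i = w' i)" if "j < Suc n" for j
    proof (cases "j = n")
      case True
      then show ?thesis
        using e e' by (intro exI[of _ e]) (auto simp: w'_def)
    next
      case False
      then have "j < n" using that by simp
      then obtain k where "d \<le> a j k" "a j (Suc k) \<le> e" "\<forall>i\<in>{a j k..<a j (Suc k)}. y j i = w i"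
        using * by blast
      then show ?thesis
        using e' by (intro exI[of _ k]) (auto simp: w'_def)
    qed
    ultimately show ?case
      using e(1) e'(2) by (intro exI[of _ "a n (Suc e)"] exI[of _ w']) auto
  qed
  obtain e w where e: "\<And>d n. d < e d n" and w: "\<And>d n. w d n \<in> Pi UNIV S" and
    ew: "\<And>d n j. j < n \<Longrightarrow> \<exists>k. d \<le> a j k \<and> a j (Suc k) \<le> e d n \<and>
      (\<forall>i\<in>{a j k..<a j (Suc k)}. y j i = w d n i)"
    using step by metis
  define b where "b = rec_nat 0 (\<lambda>n d. e d n)"
  have b_Suc: "b (Suc n) = e (b n) n" for n
    by (simp add: b_def)
  have b: "partition_seq b"
    unfolding partition_seq_def strict_mono_Suc_iff using e by (simp add: b_Suc) (simp add: b_def)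
  obtain z where z: "z \<in> Pi UNIV S" "\<And>n i. i \<in> {b n..<b (Suc n)} \<Longrightarrow> z i = w (b n) n i"
    using partition_seq_glue[OF b, of "\<lambda>n. w (b n) n"] w by metis
  have "engulfs (b, z) (a j, y j)" for j
    unfolding engulfs.simps using eventually_gt_at_top[of j]
  proof eventually_elim
    case (elim n)
    obtain k where k: "b n \<le> a j k" "a j (Suc k) \<le> b (Suc n)"
      "\<forall>i\<in>{a j k..<a j (Suc k)}. y j i = w (b n) n i"
      using ew[OF elim] b_Suc by metis
    then show ?case
      using z(2)[of _ n] by (intro exI[of _ k]) auto
  qed
  moreover have "(b, z) \<in> match_codes S"
    using b z(1) by (simp add: match_codes_def)
  ultimately show thesis
    using that[of "(b, z)"] by (simp add: a_def y_def)
qed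

section \<open>Matching ideals are proper and closed under countable unions\<close>

lemma matching_ideal_down: "A \<in> matching_ideal S \<Longrightarrow> B \<subseteq> A \<Longrightarrow> B \<in> matching_ideal S"
  unfolding matching_ideal_def by blast

lemma matching_ideal_Pow: "\<forall>A\<in>matching_ideal S. Pow A \<subseteq> matching_ideal S"
  unfolding matching_ideal_def by blast

lemma match_set_in_matching_ideal: "p \<in> match_codes S \<Longrightarrow> match_set S p \<in> matching_ideal S"
  unfolding matching_ideal_def by blast

lemma match_set_subset_Pi: "match_set S p \<subseteq> Pi UNIV S"
  by (cases p) auto

lemma partition_seq_id: "partition_seq id"
  by (simp add: partition_seq_def strict_mono_def)

lemma matching_ideal_Union:
  assumes "countable \<C>" "\<C> \<subseteq> matching_ideal S" "Pi UNIV S \<noteq> {}"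
  shows "\<Union>\<C> \<in> matching_ideal S"
proof (cases "\<C> = {}")
  case True
  \<comment> \<open>The empty family still needs some code, hence a point of the product.\<close>
  obtain y where "y \<in> Pi UNIV S" using assms(3) by blast
  then have "(id, y) \<in> match_codes S"
    by (simp add: match_codes_def partition_seq_id)
  then show ?thesis using True by (auto simp: matching_ideal_def)
next
  case False
  have "\<exists>p. p \<in> match_codes S \<and> from_nat_into \<C> j \<subseteq> match_set S p" for j
    using from_nat_into[OF False] assms(2) unfolding matching_ideal_def by blast
  then obtain p where p: "\<And>j. p j \<in> match_codes S" "\<And>j. from_nat_into \<C> j \<subseteq> match_set S (p j)"
    by metis
  obtain q where q: "q \<in> match_codes S" "\<And>j. engulfs q (p j)"
    using match_codes_directed[of p, OF p(1)] by blast
  have "from_nat_into \<C> j \<subseteq> match_set S q" for j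
    using engulfs_imp_match_set_subset[OF p(1) q] p(2) by blast
  then have "\<Union>\<C> \<subseteq> match_set S q"
    using range_from_nat_into[OF False assms(1)] by blast
  then show ?thesis using q(1) by (auto simp: matching_ideal_def)
qed

text \<open>Every point \<open>x\<close> lies in the matching set of \<open>(id, x)\<close>, whose
  blocks are single points, so the ideal covers the product. A point that differs from
  \<open>z\<close> at all positive coordinates escapes any given matching set.\<close>

lemma matching_ideal_proper:
  assumes two: "\<And>n c. n > 0 \<Longrightarrow> \<exists>d\<in>S n. d \<noteq> c" and ne: "S 0 \<noteq> {}"
  shows "\<Union>(matching_ideal S) \<notin> matching_ideal S"
proof
  assume "\<Union>(matching_ideal S) \<in> matching_ideal S"
  then obtain b z where q: "(b, z) \<in> match_codes S" "\<Union>(matching_ideal S) \<subseteq> match_set S (b, z)"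
    by (auto simp: matching_ideal_def)
  then have b: "partition_seq b" by (simp add: match_codes_def)
  have "\<exists>d. d \<in> S n \<and> (n > 0 \<longrightarrow> d \<noteq> z n)" for n
    using two[of n "z n"] ne by (cases "n = 0") auto
  then obtain x where x: "\<And>n. x n \<in> S n" "\<And>n. n > 0 \<Longrightarrow> x n \<noteq> z n"
    by metis
  have "(id, x) \<in> match_codes S"
    using x by (simp add: match_codes_def partition_seq_id)
  moreover have "x \<in> match_set S (id, x)"
    using x(1) by simp
  ultimately have "x \<in> match_set S (b, z)"
    using q(2) match_set_in_matching_ideal by blast
  then obtain N where N: "\<And>n. n \<ge> N \<Longrightarrow> \<exists>i\<in>{b n..<b (Suc n)}. x i = z i"
    by (auto simp: eventually_sequentially)
  \<comment> \<open>Block \<open>Suc N\<close> avoids coordinate 0, the only place where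
    \<open>x\<close> and \<open>z\<close> may agree.\<close>
  obtain i where i: "b (Suc N) \<le> i" "x i = z i"
    using N[of "Suc N"] by auto
  then have "i > 0" using partition_seq_ge[OF b, of "Suc N"] by simp
  then show False using x(2) i(2) by blast
qed

text \<open>Maps between codes lift to maps between ideals by choosing a code for each member.
  Inclusion is turned into engulfing only on the side of \<open>T\<close>, so two values are asked
  of \<open>T\<close> alone.\<close>

lemma tukey_reducible_matching_idealI:
  fixes S :: "nat \<Rightarrow> 'a set" and T :: "nat \<Rightarrow> 'b set"
  assumes \<phi>: "\<And>p. p \<in> match_codes S \<Longrightarrow> \<phi> p \<in> match_codes T"
    and \<psi>: "\<And>q. q \<in> match_codes T \<Longrightarrow> \<psi> q \<in> match_codes S"
    and \<phi>\<psi>: "\<And>p q. p \<in> match_codes S \<Longrightarrow> q \<in> match_codes T \<Longrightarrow> engulfs q (\<phi> p) \<Longrightarrow> engulfs (\<psi> q) p"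
    and two: "\<And>n c. n > 0 \<Longrightarrow> \<exists>d\<in>T n. d \<noteq> c"
  shows "tukey_reducible (matching_ideal S) (matching_ideal T)"
proof -
  have "\<exists>p. p \<in> match_codes S \<and> A \<subseteq> match_set S p" if "A \<in> matching_ideal S" for A
    using that unfolding matching_ideal_def by blast
  then obtain u where u: "\<And>A. A \<in> matching_ideal S \<Longrightarrow> u A \<in> match_codes S \<and> A \<subseteq> match_set S (u A)"
    by metis
  have "\<exists>q. q \<in> match_codes T \<and> B \<subseteq> match_set T q" if "B \<in> matching_ideal T" for B
    using that unfolding matching_ideal_def by blast
  then obtain v where v: "\<And>B. B \<in> matching_ideal T \<Longrightarrow> v B \<in> match_codes T \<and> B \<subseteq> match_set T (v B)"
    by metis
  let ?f = "\<lambda>A. match_set T (\<phi> (u A))" and ?g = "\<lambda>B. match_set S (\<psi> (v B))"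
  have "A \<subseteq> ?g B" if A: "A \<in> matching_ideal S" and B: "B \<in> matching_ideal T" and sub: "?f A \<subseteq> B" for A B
  proof -
    have "engulfs (v B) (\<phi> (u A))"
      using match_set_subset_imp_engulfs[OF \<phi> _ two] u[OF A] v[OF B] sub by blast
    then have "engulfs (\<psi> (v B)) (u A)"
      using \<phi>\<psi> u[OF A] v[OF B] by blast
    then have "match_set S (u A) \<subseteq> ?g B"
      using engulfs_imp_match_set_subset \<psi> u[OF A] v[OF B] by blast
    then show ?thesis using u[OF A] by blast
  qed
  moreover have "?f A \<in> matching_ideal T" if "A \<in> matching_ideal S" for A
    using \<phi> u[OF that] match_set_in_matching_ideal by blast
  moreover have "?g B \<in> matching_ideal S" if "B \<in> matching_ideal T" for B
    using \<psi> v[OF that] match_set_in_matching_ideal by blast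
  ultimately show ?thesis
    unfolding tukey_reducible_def
    by (intro exI[of _ ?f] exI[of _ ?g] conjI image_subsetI ballI impI)
qed

section \<open>Meager sets in the Cantor space\<close>

lemma open_cylinder:
  fixes x :: "nat \<Rightarrow> bool"
  shows "open {u. \<forall>i<n. u i = x i}"
proof -
  have "open ((\<lambda>u::nat \<Rightarrow> bool. u i) -` {x i})" for i
    by (rule open_vimage) (auto intro: open_discrete continuous_on_product_coordinates)
  then have "open (\<Inter>i<n. (\<lambda>u. u i) -` {x i})"
    by (intro open_INT) auto
  moreover have "(\<Inter>i<n. (\<lambda>u. u i) -` {x i}) = {u. \<forall>i<n. u i = x i}"
    by auto
  ultimately show ?thesis by simp
qed

lemma open_contains_cylinder:
  fixes U :: "(nat \<Rightarrow> bool) set"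
  assumes "open U" "x \<in> U"
  obtains n where "{u. \<forall>i<n. u i = x i} \<subseteq> U"
proof -
  obtain V where V: "finite {i. V i \<noteq> (UNIV :: bool set)}" "x \<in> Pi\<^sub>E UNIV V" "Pi\<^sub>E UNIV V \<subseteq> U"
    using assms(1)[unfolded open_fun_def openin_product_topology_alt, THEN bspec, OF assms(2)]
    by auto
  obtain n where n: "i < n" if "V i \<noteq> UNIV" for i
    using V(1) finite_nat_set_iff_bounded by auto
  have "u i \<in> V i" if "\<forall>i<n. u i = x i" for u i
    using n[of i] V(2) that by (cases "V i = UNIV") (auto simp: PiE_iff)
  then have "{u. \<forall>i<n. u i = x i} \<subseteq> Pi\<^sub>E UNIV V"
    by (auto simp: PiE_iff)
  then show thesis
    by (rule that[OF subset_trans[OF _ V(3)]])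
qed

lemma nowhere_dense_avoid_cylinder:
  fixes N :: "(nat \<Rightarrow> bool) set"
  assumes "nowhere_dense N"
  obtains x' m where "n < m" "\<And>i. i < n \<Longrightarrow> x' i = x i" "\<And>u. \<forall>i<m. u i = x' i \<Longrightarrow> u \<notin> N"
proof -
  have "\<not> {u. \<forall>i<n. u i = x i} \<subseteq> closure N"
  proof
    assume "{u. \<forall>i<n. u i = x i} \<subseteq> closure N"
    then have "x \<in> interior (closure N)"
      using open_cylinder by (intro interiorI) auto
    then show False using assms by (simp add: nowhere_dense_def)
  qed
  then obtain x' where x': "\<forall>i<n. x' i = x i" "x' \<in> - closure N"
    by blast
  obtain m where m: "{u. \<forall>i<m. u i = x' i} \<subseteq> - closure N"
    by (rule open_contains_cylinder[OF open_Compl[OF closed_closure] x'(2)])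
  have "u \<notin> N" if "\<forall>i<max m (Suc n). u i = x' i" for u
  proof -
    have "u \<in> - closure N"
      using that by (intro subsetD[OF m]) simp
    then show ?thesis
      using closure_subset[of N] by blast
  qed
  then show thesis
    using that[of "max m (Suc n)" x'] x'(1) by auto
qed

text \<open>Only finitely many patterns exist below \<open>n\<close>. They are treated one after
  another, each time lengthening the word so that the current pattern followed by it avoids
  \<open>N\<close>.\<close>

lemma nowhere_dense_avoid_block:
  fixes N :: "(nat \<Rightarrow> bool) set"
  assumes "nowhere_dense N"
  shows "\<exists>m w. n < m \<and> (\<forall>u. (\<forall>i\<in>{n..<m}. u i = w i) \<longrightarrow> u \<notin> N)"
proof -
  let ?T = "{s::nat \<Rightarrow> bool. \<forall>i. (i \<in> {..<n} \<longrightarrow> s i \<in> UNIV) \<and> (i \<notin> {..<n} \<longrightarrow> s i = False)}"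
  have fin: "finite ?T"
    by (rule finite_set_of_finite_funs) auto
  have ex: "\<exists>m w. n < m \<and> (\<forall>s\<in>T. \<forall>u. (\<forall>i<n. u i = s i) \<and> (\<forall>i\<in>{n..<m}. u i = w i) \<longrightarrow> u \<notin> N)"
    if "finite T" for T
    using that
  proof induction
    case empty
    show ?case by auto
  next
    case (insert s T)
    obtain m w where mw: "n < m"
      "\<forall>s\<in>T. \<forall>u. (\<forall>i<n. u i = s i) \<and> (\<forall>i\<in>{n..<m}. u i = w i) \<longrightarrow> u \<notin> N"
      using insert.IH by (elim exE conjE)
    obtain w' m' where w': "m < m'" "\<And>i. i < m \<Longrightarrow> w' i = (if i < n then s i else w i)"
      "\<And>u. \<forall>i<m'. u i = w' i \<Longrightarrow> u \<notin> N"
      by (rule nowhere_dense_avoid_cylinder[OF assms, of m "\<lambda>i. if i < n then s i else w i"])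
        (rule that)
    have "\<forall>s\<in>insert s T. \<forall>u. (\<forall>i<n. u i = s i) \<and> (\<forall>i\<in>{n..<m'}. u i = w' i) \<longrightarrow> u \<notin> N"
    proof (intro ballI allI impI, elim conjE, goal_cases)
      case (1 t u)
      note t = 1(1) and ut = 1(2) and uw = 1(3)
      show ?case
      proof (cases "t = s")
        case True
        have "u i = w' i" if "i < m'" for i
          using that ut uw w'(2)[of i] mw(1) True by (cases "i < n") auto
        then show ?thesis using w'(3) by blast
      next
        case False
        have "\<forall>i\<in>{n..<m}. u i = w i"
          using uw w'(1,2) by auto
        moreover have "t \<in> T" using t False by simp
        ultimately show ?thesis using mw(2) ut by simp
      qed
    qed
    moreover have "n < m'" using mw(1) w'(1) by simp
    ultimately show ?case
      by (intro exI[of _ m'] exI[of _ w'] conjI)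
  qed
  obtain m w where mw: "n < m"
    "\<forall>s\<in>?T. \<forall>u. (\<forall>i<n. u i = s i) \<and> (\<forall>i\<in>{n..<m}. u i = w i) \<longrightarrow> u \<notin> N"
    using ex[OF fin] by (elim exE conjE)
  have "u \<notin> N" if "\<forall>i\<in>{n..<m}. u i = w i" for u
    \<comment> \<open>The pattern of \<open>u\<close> below \<open>n\<close>, padded with
      \<open>False\<close> as in \<open>?T\<close>.\<close>
    using bspec[OF mw(2), of "\<lambda>i. i < n \<and> u i"] that by simp
  then show ?thesis using mw(1) by (intro exI conjI allI impI)
qed

text \<open>On each block \<open>y\<close> is the negation of an avoided word: a sequence that never
  agrees with \<open>y\<close> on the block copies the word and so lies outside
  \<open>N\<close>.\<close>

lemma nowhere_dense_in_matching_ideal: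
  fixes N :: "(nat \<Rightarrow> bool) set"
  assumes "nowhere_dense N"
  shows "N \<in> matching_ideal (\<lambda>_. UNIV)"
proof -
  obtain e w where e: "\<And>n. n < e n" and w: "\<And>n u. \<forall>i\<in>{n..<e n}. u i = w n i \<Longrightarrow> u \<notin> N"
    using nowhere_dense_avoid_block[OF assms] by metis
  define a where "a = rec_nat 0 (\<lambda>_. e)"
  have a_Suc: "a (Suc n) = e (a n)" for n
    by (simp add: a_def)
  have a: "partition_seq a"
    unfolding partition_seq_def strict_mono_Suc_iff using e by (simp add: a_Suc) (simp add: a_def)
  obtain y where y: "\<And>n i. i \<in> {a n..<a (Suc n)} \<Longrightarrow> y i = (\<not> w (a n) i)"
    using partition_seq_glue[OF a, of "\<lambda>n i. \<not> w (a n) i" "\<lambda>_. UNIV"] by auto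
  have "\<exists>i\<in>{a n..<a (Suc n)}. x i = y i" if "x \<in> N" for x n
  proof (rule ccontr)
    assume "\<not> ?thesis"
    then have "\<forall>i\<in>{a n..<e (a n)}. x i = w (a n) i"
      using y[of _ n] by (auto simp: a_Suc)
    then show False using w that by blast
  qed
  then have "N \<subseteq> match_set (\<lambda>_. UNIV) (a, y)"
    by auto
  moreover have "(a, y) \<in> match_codes (\<lambda>_. UNIV)"
    using a by (simp add: match_codes_def)
  ultimately show ?thesis unfolding matching_ideal_def by blast
qed

text \<open>The set is closed, each block imposing a finite union of closed conditions, and every
  cylinder contains a sequence opposite to \<open>y\<close> from some point on.\<close>

lemma nowhere_dense_matching:
  fixes y :: "nat \<Rightarrow> bool"
  assumes a: "partition_seq a"
  shows "nowhere_dense {x. \<forall>n\<ge>m. \<exists>i\<in>{a n..<a (Suc n)}. x i = y i}" (is "nowhere_dense ?N")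
proof -
  have "closed {x :: nat \<Rightarrow> bool. x i = y i}" for i
    by (intro closed_Collect_eq continuous_on_product_coordinates continuous_on_const)
  then have "closed (\<Inter>n\<in>{m..}. \<Union>i\<in>{a n..<a (Suc n)}. {x. x i = y i})"
    by (intro closed_INT ballI closed_UN) auto
  moreover have "(\<Inter>n\<in>{m..}. \<Union>i\<in>{a n..<a (Suc n)}. {x. x i = y i}) = ?N"
    by auto
  ultimately have "closed ?N" by simp
  moreover have "interior ?N = {}"
  proof (rule ccontr)
    assume "interior ?N \<noteq> {}"
    then obtain x where x: "x \<in> interior ?N" by blast
    obtain l where l: "{u. \<forall>i<l. u i = x i} \<subseteq> interior ?N"
      by (rule open_contains_cylinder[OF open_interior x])
    let ?u = "\<lambda>i. if i < l then x i else \<not> y i"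
    have "?u \<in> interior ?N"
      by (rule subsetD[OF l]) simp
    then have "?u \<in> ?N"
      by (rule subsetD[OF interior_subset])
    then have "\<forall>n\<ge>m. \<exists>i\<in>{a n..<a (Suc n)}. ?u i = y i"
      by (rule CollectD)
    then obtain i where i: "i \<in> {a (max l m)..<a (Suc (max l m))}" "?u i = y i"
      by (meson max.cobounded2)
    have "l \<le> i"
      using i(1) partition_seq_ge[OF a, of "max l m"] by simp
    then show False using i(2) by simp
  qed
  ultimately show ?thesis by (simp add: nowhere_dense_def)
qed

lemma meager_subset:
  assumes "meager A" "B \<subseteq> A"
  shows "meager B"
proof -
  obtain \<C> where \<C>: "countable \<C>" "\<forall>N\<in>\<C>. nowhere_dense N" "A = \<Union>\<C>"
    using assms(1) by (auto simp: meager_def)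
  have "nowhere_dense (B \<inter> N)" if "N \<in> \<C>" for N
    using \<C>(2) that interior_mono[OF closure_mono[of "B \<inter> N" N]] by (auto simp: nowhere_dense_def)
  then show ?thesis
    unfolding meager_def using \<C> assms(2)
    by (intro exI[of _ "(\<lambda>N. B \<inter> N) ` \<C>"]) auto
qed

text \<open>A matching set is the union over \<open>m\<close> of the nowhere dense sets of sequences
  that match on all blocks from \<open>m\<close> on. Conversely, nowhere dense sets lie in the
  matching ideal, which absorbs countable unions.\<close>

lemma meager_ideal_eq: "meager_ideal = matching_ideal (\<lambda>_. UNIV)"
proof (intro set_eqI iffI)
  fix A :: "(nat \<Rightarrow> bool) set" assume "A \<in> meager_ideal"
  then obtain \<C> where \<C>: "countable \<C>" "\<forall>N\<in>\<C>. nowhere_dense N" "A = \<Union>\<C>"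
    by (auto simp: meager_ideal_def meager_def)
  then have "\<C> \<subseteq> matching_ideal (\<lambda>_. UNIV)"
    using nowhere_dense_in_matching_ideal by blast
  then show "A \<in> matching_ideal (\<lambda>_. UNIV)"
    using matching_ideal_Union[OF \<C>(1)] \<C>(3) by simp
next
  fix A :: "(nat \<Rightarrow> bool) set" assume "A \<in> matching_ideal (\<lambda>_. UNIV)"
  then obtain a y where a: "partition_seq a" and A: "A \<subseteq> match_set (\<lambda>_. UNIV) (a, y)"
    by (auto simp: matching_ideal_def match_codes_def)
  let ?N = "\<lambda>m. {x. \<forall>n\<ge>m. \<exists>i\<in>{a n..<a (Suc n)}. x i = y i}"
  have "match_set (\<lambda>_. UNIV) (a, y) = \<Union>(range ?N)"
    by (auto simp: eventually_sequentially)
  then have "meager (match_set (\<lambda>_. UNIV) (a, y))"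
    unfolding meager_def using nowhere_dense_matching[OF a]
    by (intro exI[of _ "range ?N"]) auto
  then show "A \<in> meager_ideal"
    using meager_subset A by (auto simp: meager_ideal_def)
qed

section \<open>The ideals \<open>\<H>\<^sub>F\<close> as matching ideals\<close>

lemma prod_space_eq: "prod_space F = Pi UNIV (\<lambda>n. {..<F n})"
  by (auto simp: prod_space_def)

lemma H_set_eq: "H_set F (\<lambda>n. {a n..<a (Suc n)}) y = match_set (\<lambda>n. {..<F n}) (a, y)"
  by (simp add: H_set_def prod_space_eq)

text \<open>The subsets of generators already form a \<open>\<sigma>\<close>-ideal, so they exhaust
  the generated one.\<close>

lemma H_ideal_eq:
  assumes "\<And>n. F n \<ge> 1"
  shows "H_ideal F = matching_ideal (\<lambda>n. {..<F n})"
proof -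
  let ?X = "prod_space F" and ?K = "matching_ideal (\<lambda>n. {..<F n})"
  let ?G = "{H_set F I y | I y. interval_partition I \<and> y \<in> ?X}"
  have G: "?G = match_set (\<lambda>n. {..<F n}) ` match_codes (\<lambda>n. {..<F n})" (is "_ = ?M")
  proof
    show "?G \<subseteq> ?M"
    proof
      fix A assume "A \<in> ?G"
      then obtain I y a where A: "A = H_set F I y" "y \<in> ?X" "partition_seq a"
        and I: "\<forall>n. I n = {a n..<a (Suc n)}"
        by (auto simp: interval_partition_def partition_seq_def)
      from I have "I = (\<lambda>n. {a n..<a (Suc n)})" by (intro ext) (rule spec)
      then have "A = match_set (\<lambda>n. {..<F n}) (a, y)"
        using A(1) H_set_eq by simp
      moreover have "(a, y) \<in> match_codes (\<lambda>n. {..<F n})"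
        using A(2,3) by (simp add: match_codes_def prod_space_eq)
      ultimately show "A \<in> ?M" by blast
    qed
    show "?M \<subseteq> ?G"
    proof clarify
      fix a y assume "(a, y) \<in> match_codes (\<lambda>n. {..<F n})"
      then have "interval_partition (\<lambda>n. {a n..<a (Suc n)})" "y \<in> ?X"
        by (auto simp: match_codes_def interval_partition_def partition_seq_def prod_space_eq)
      then show "\<exists>I z. match_set (\<lambda>n. {..<F n}) (a, y) = H_set F I z \<and> interval_partition I \<and> z \<in> ?X"
        using H_set_eq[of F a y] by metis
    qed
  qed
  have "(\<lambda>_. 0) \<in> Pi UNIV (\<lambda>n. {..<F n})"
    using assms by (auto simp: Suc_le_eq)
  then have ne: "Pi UNIV (\<lambda>n. {..<F n}) \<noteq> {}"
    by blast
  have K: "sigma_ideal ?X ?K"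
    unfolding sigma_ideal_def prod_space_eq
  proof (intro conjI ballI allI impI; (elim conjE)?)
    show "?K \<subseteq> Pow (Pi UNIV (\<lambda>n. {..<F n}))"
      unfolding matching_ideal_def using match_set_subset_Pi by blast
    show "B \<in> ?K" if "A \<in> ?K" "B \<subseteq> A" for A B
      using that by (rule matching_ideal_down)
    show "\<Union>\<C> \<in> ?K" if "countable \<C>" "\<C> \<subseteq> ?K" for \<C>
      using that ne by (rule matching_ideal_Union)
  qed
  have GK: "?G \<subseteq> ?K"
    unfolding G by (intro image_subsetI match_set_in_matching_ideal)
  have least: "?K \<subseteq> J" if J: "sigma_ideal ?X J" "?G \<subseteq> J" for J
  proof
    fix A assume "A \<in> ?K"
    then obtain p where p: "p \<in> match_codes (\<lambda>n. {..<F n})" "A \<subseteq> match_set (\<lambda>n. {..<F n}) p"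
      unfolding matching_ideal_def by blast
    have "match_set (\<lambda>n. {..<F n}) p \<in> J"
      using J(2) unfolding G by (rule subsetD[OF _ imageI[OF p(1)]])
    then show "A \<in> J"
      using J(1) p(2) unfolding sigma_ideal_def by simp
  qed
  show ?thesis
    unfolding H_ideal_def sigma_ideal_generated_def
  proof (rule equalityI)
    show "\<Inter>{J. sigma_ideal ?X J \<and> ?G \<subseteq> J} \<subseteq> ?K"
      by (rule Inter_lower) (intro CollectI conjI K GK)
    show "?K \<subseteq> \<Inter>{J. sigma_ideal ?X J \<and> ?G \<subseteq> J}"
      using least by (intro Inter_greatest) (elim CollectE conjE)
  qed
qed

section \<open>Reductions between bit sequences and bounded sequences\<close>

lemma lessThan_two_values:
  fixes c :: nat
  assumes "m \<ge> 2"
  shows "\<exists>d\<in>{..<m}. d \<noteq> c"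
  using assms by (intro bexI[of _ "if c = 0 then 1 else 0"]) auto

lemma tukey_reducible_bool:
  fixes F :: "nat \<Rightarrow> nat"
  assumes F: "\<And>n. n > 0 \<Longrightarrow> F n \<ge> 2" "F 0 \<ge> 1"
  shows "tukey_reducible (matching_ideal (\<lambda>_. UNIV :: bool set)) (matching_ideal (\<lambda>n. {..<F n}))"
proof -
  \<comment> \<open>Bits become the values 0 and 1, except that coordinate 0 is sent to 0 because
    \<open>F 0\<close> may be 1.\<close>
  define c where "c y i = (if i > 0 \<and> y i then 1 else 0 :: nat)" for y :: "nat \<Rightarrow> bool" and i
  let ?\<phi> = "\<lambda>(a::nat \<Rightarrow> nat, y). (a, c y)"
  let ?\<psi> = "\<lambda>(b::nat \<Rightarrow> nat, z::nat \<Rightarrow> nat). (b, \<lambda>i. z i = 1)"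
  show ?thesis
  proof (rule tukey_reducible_matching_idealI[where \<phi> = ?\<phi> and \<psi> = ?\<psi>])
    show "\<exists>d\<in>{..<F n}. d \<noteq> c" if "n > 0" for n c
      using lessThan_two_values[OF F(1)[OF that]] .
    have "c y i < F i" for y i
      using F(1)[of i] F(2) by (cases "i = 0") (auto simp: c_def)
    then show "?\<phi> p \<in> match_codes (\<lambda>n. {..<F n})" if "p \<in> match_codes (\<lambda>_. UNIV)" for p
      using that by (auto simp: match_codes_def)
    show "?\<psi> q \<in> match_codes (\<lambda>_. UNIV)" if "q \<in> match_codes (\<lambda>n. {..<F n})" for q
      using that by (auto simp: match_codes_def)
    fix p :: "(nat \<Rightarrow> nat) \<times> (nat \<Rightarrow> bool)" and q
    assume q: "q \<in> match_codes (\<lambda>n. {..<F n})" and e: "engulfs q (?\<phi> p)"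
    obtain a y b z where pq: "p = (a, y)" "q = (b, z)" "partition_seq b"
      using q by (cases p) (auto simp: match_codes_def)
    show "engulfs (?\<psi> q) p"
      \<comment> \<open>Blocks with \<open>n > 0\<close> omit coordinate 0, where \<open>c\<close>
        forgets the bit.\<close>
      using e eventually_gt_at_top[of 0] unfolding pq prod.case engulfs.simps
    proof eventually_elim
      case (elim n)
      then obtain k where k: "b n \<le> a k" "a (Suc k) \<le> b (Suc n)"
        "\<forall>i\<in>{a k..<a (Suc k)}. c y i = z i" by blast
      have pos: "i > 0" if "i \<in> {a k..<a (Suc k)}" for i
        using that k(1) elim(2) partition_seq_ge[OF pq(3), of n] by simp
      have "y i = (z i = 1)" if "i \<in> {a k..<a (Suc k)}" for i
        using pos[OF that] bspec[OF k(3) that] by (cases "y i") (auto simp: c_def)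
      then show ?case using k(1,2) by blast
    qed
  qed
qed

text \<open>
  The value \<open>y n < F n\<close> is encoded in unary: of the \<open>F n\<close> bits starting at position
  \<open>s n\<close>, exactly the one with offset \<open>y n\<close> is set.
\<close>
lemma unary_code:
  fixes F s :: "nat \<Rightarrow> nat"
  assumes s: "partition_seq s" and s_Suc: "\<And>n. s (Suc n) = s n + F n"
  obtains code :: "(nat \<Rightarrow> nat) \<Rightarrow> nat \<Rightarrow> bool" and decode :: "(nat \<Rightarrow> bool) \<Rightarrow> nat \<Rightarrow> nat"
  where "\<And>z n. decode z n < F n"
    and "\<And>y z n. y n < F n \<Longrightarrow> \<forall>i\<in>{s n..<s (Suc n)}. code y i = z i \<Longrightarrow> decode z n = y n"
proof -
  have F: "0 < F n" for n
    using partition_seq_less_iff[OF s, of n "Suc n"] by (simp add: s_Suc)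
  define code :: "(nat \<Rightarrow> nat) \<Rightarrow> nat \<Rightarrow> bool" where "code y i \<longleftrightarrow> (\<exists>n. i = s n + y n \<and> y n < F n)" for y i
  \<comment> \<open>The decoder picks a set bit of the block if there is one and an arbitrary
    admissible offset otherwise, so it is total.\<close>
  define P where "P z n v \<longleftrightarrow> v < F n \<and> ((\<exists>v<F n. z (s n + v)) \<longrightarrow> z (s n + v))"
    for z :: "nat \<Rightarrow> bool" and n v
  define decode where "decode z n = (SOME v. P z n v)" for z n
  have "\<exists>v. P z n v" for z n
    using F[of n] by (auto simp: P_def)
  then have P: "P z n (decode z n)" for z n
    unfolding decode_def by (rule someI_ex)
  have "decode z n = y n" if y: "y n < F n" and eq: "\<forall>i\<in>{s n..<s (Suc n)}. code y i = z i" for y z n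
  proof -
    have in_block: "s m + v \<in> {s m..<s (Suc m)}" if "v < F m" for m v
      using that by (simp add: s_Suc)
    have "z (s n + y n)"
      using y bspec[OF eq in_block[OF y]] by (auto simp: code_def)
    then have v: "decode z n < F n" "z (s n + decode z n)"
      using P[of z n] y by (auto simp: P_def)
    then have "code y (s n + decode z n)"
      using bspec[OF eq in_block[OF v(1)]] by simp
    then obtain m where m: "s n + decode z n = s m + y m" "y m < F m"
      by (auto simp: code_def)
    have "m = n"
      using partition_seq_block_unique[OF s, of n "s n + decode z n" m]
        in_block[OF v(1)] in_block[OF m(2)] m(1) by simp
    then show ?thesis using m(1) by simp
  qed
  moreover have "decode z n < F n" for z n
    using P by (simp add: P_def)
  ultimately show thesis
    using that[of decode code] by simp
qed

text \<open>Coordinate \<open>n\<close> occupies the bits from \<open>s n\<close> to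
  \<open>s (Suc n)\<close>, so \<open>s \<circ> a\<close> is the partition \<open>a\<close> seen on
  bits. Agreement on the bits of a block decodes to agreement on its coordinates.\<close>

lemma tukey_reducible_to_bool:
  fixes F :: "nat \<Rightarrow> nat"
  assumes F: "\<And>n. F n \<ge> 1"
  shows "tukey_reducible (matching_ideal (\<lambda>n. {..<F n})) (matching_ideal (\<lambda>_. UNIV :: bool set))"
proof -
  define s where "s n = (\<Sum>i<n. F i)" for n
  have s_Suc: "s (Suc n) = s n + F n" for n
    by (simp add: s_def)
  have s: "partition_seq s"
    unfolding partition_seq_def strict_mono_Suc_iff using F
    by (simp add: s_Suc Suc_le_eq) (simp add: s_def)
  obtain code :: "(nat \<Rightarrow> nat) \<Rightarrow> nat \<Rightarrow> bool" and decode where dec: "\<And>z n. decode z n < F n"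
    and code: "\<And>y z n. y n < F n \<Longrightarrow> \<forall>i\<in>{s n..<s (Suc n)}. code y i = z i \<Longrightarrow> decode z n = y n"
    by (rule unary_code[OF s s_Suc]) (rule that)
  \<comment> \<open>From coordinate \<open>d\<close>, take bit block number \<open>s d\<close> of
    \<open>b\<close>: it starts at or after bit \<open>s d\<close>, and since
    \<open>i \<le> s i\<close>, every coordinate coded inside it lies between \<open>d\<close> and
    the next endpoint \<open>b (Suc (s d))\<close>.\<close>
  define B where "B b = rec_nat 0 (\<lambda>_ d. b (Suc (s d)))" for b :: "nat \<Rightarrow> nat"
  have B_Suc: "B b (Suc n) = b (Suc (s (B b n)))" for b n
    by (simp add: B_def)
  have B: "partition_seq (B b)" if b: "partition_seq b" for b
  proof -
    have "d < b (Suc (s d))" for d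
      using partition_seq_ge[OF s, of d] partition_seq_ge[OF b, of "Suc (s d)"] by simp
    then show ?thesis
      unfolding partition_seq_def strict_mono_Suc_iff by (simp add: B_Suc) (simp add: B_def)
  qed
  let ?\<phi> = "\<lambda>(a :: nat \<Rightarrow> nat, y). (s \<circ> a, code y)" and ?\<psi> = "\<lambda>(b, z). (B b, decode z)"
  show ?thesis
  proof (rule tukey_reducible_matching_idealI[where \<phi> = ?\<phi> and \<psi> = ?\<psi>])
    show "?\<phi> p \<in> match_codes (\<lambda>_. UNIV)" if "p \<in> match_codes (\<lambda>n. {..<F n})" for p
      using s that by (auto simp: match_codes_def partition_seq_def strict_mono_o)
    show "?\<psi> q \<in> match_codes (\<lambda>n. {..<F n})" if "q \<in> match_codes (\<lambda>_. UNIV)" for q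
      using B dec that by (auto simp: match_codes_def)
    fix p :: "(nat \<Rightarrow> nat) \<times> (nat \<Rightarrow> nat)" and q :: "(nat \<Rightarrow> nat) \<times> (nat \<Rightarrow> bool)"
    assume p: "p \<in> match_codes (\<lambda>n. {..<F n})" and q: "q \<in> match_codes (\<lambda>_. UNIV)"
      and e: "engulfs q (?\<phi> p)"
    obtain a y b z where pq: "p = (a, y)" "q = (b, z)"
      by (cases p, cases q)
    have a: "partition_seq a" and b: "partition_seq b" and y: "y n < F n" for n
      using p q by (auto simp: pq match_codes_def)
    obtain N where N: "\<And>n. n \<ge> N \<Longrightarrow> \<exists>k. b n \<le> s (a k) \<and> s (a (Suc k)) \<le> b (Suc n) \<and>
        (\<forall>i\<in>{s (a k)..<s (a (Suc k))}. code y i = z i)"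
      using e by (auto simp: pq eventually_sequentially)
    have "\<exists>k. B b n \<le> a k \<and> a (Suc k) \<le> B b (Suc n) \<and> (\<forall>i\<in>{a k..<a (Suc k)}. y i = decode z i)"
      if n: "n \<ge> N" for n
    proof -
      let ?m = "s (B b n)"
      have "N \<le> ?m"
        using n partition_seq_ge[OF s, of "B b n"] partition_seq_ge[OF B[OF b], of n] by simp
      then obtain k where k: "b ?m \<le> s (a k)" "s (a (Suc k)) \<le> b (Suc ?m)"
        "\<forall>i\<in>{s (a k)..<s (a (Suc k))}. code y i = z i"
        using N by blast
      have "s (B b n) \<le> s (a k)"
        using k(1) partition_seq_ge[OF b, of ?m] by simp
      then have "B b n \<le> a k"
        using partition_seq_le_iff[OF s] by simp
      moreover have "a (Suc k) \<le> B b (Suc n)"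
        using k(2) partition_seq_ge[OF s, of "a (Suc k)"] by (simp add: B_Suc)
      moreover have "y i = decode z i" if i: "i \<in> {a k..<a (Suc k)}" for i
      proof -
        have "s (a k) \<le> s i" "s (Suc i) \<le> s (a (Suc k))"
          using i partition_seq_le_iff[OF s] by auto
        then show ?thesis
          using code[of y i z] y[of i] k(3) by auto
      qed
      ultimately show ?thesis by blast
    qed
    then show "engulfs (?\<psi> q) p"
      by (auto simp: pq eventually_sequentially)
  qed auto
qed

section \<open>Equality of the invariants for each increasing function\<close>

lemma increasing_seq_gt: "increasing_seq F \<Longrightarrow> F n > n"
  by (induction n) (auto simp: increasing_seq_def Suc_le_eq intro: le_less_trans)

lemma additivity_cofinality_H_ideal:
  assumes "increasing_seq F"
  shows "additivity meager_ideal =o additivity (H_ideal F)"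
    and "cofinality meager_ideal =o cofinality (H_ideal F)"
proof -
  have F: "F n \<ge> 1" for n
    using assms by (simp add: increasing_seq_def)
  have F2: "F n \<ge> 2" if "n > 0" for n
    using increasing_seq_gt[OF assms, of n] that by simp
  let ?J = "matching_ideal (\<lambda>_. UNIV :: bool set)" and ?K = "matching_ideal (\<lambda>n. {..<F n})"
  note JK = tukey_reducible_bool[of F, OF F2 F] and KJ = tukey_reducible_to_bool[of F, OF F]
  have "\<Union>?J \<notin> ?J"
    by (rule matching_ideal_proper) auto
  moreover have "0 \<in> {..<F 0}"
    using F[of 0] by simp
  then have "\<Union>?K \<notin> ?K"
    by (intro matching_ideal_proper[OF lessThan_two_values[OF F2]]) auto
  ultimately have "additivity ?J =o additivity ?K"
    using tukey_reducible_additivity[OF JK matching_ideal_Pow matching_ideal_Pow]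
      tukey_reducible_additivity[OF KJ matching_ideal_Pow matching_ideal_Pow]
    by (simp add: ordIso_iff_ordLeq)
  then show "additivity meager_ideal =o additivity (H_ideal F)"
    by (simp add: meager_ideal_eq H_ideal_eq[OF F])
  have "cofinality ?J =o cofinality ?K"
    using tukey_reducible_cofinality[OF JK] tukey_reducible_cofinality[OF KJ]
    by (simp add: ordIso_iff_ordLeq)
  then show "cofinality meager_ideal =o cofinality (H_ideal F)"
    by (simp add: meager_ideal_eq H_ideal_eq[OF F])
qed

theorem corollary3p20:
  shows "is_min_card (additivity meager_ideal) {additivity (H_ideal F) | F. increasing_seq F} \<and>
         is_max_card (cofinality meager_ideal) {cofinality (H_ideal F) | F. increasing_seq F}"
proof -
  \<comment> \<open>The minimum and the maximum must be attained, so some increasing function has to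
    exist.\<close>
  have "increasing_seq Suc"
    by (simp add: increasing_seq_def)
  then show ?thesis
    unfolding is_min_card_def is_max_card_def
    using additivity_cofinality_H_ideal ordIso_iff_ordLeq by blast
qed

end
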